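(* Consider the problem $$(P)\qquad \inf_{x_1,\ldots,x_T}\ \sum_{t=1}^{T} f_t(x_t,x_{t-1})\quad\text{s.t. } x_t\in\mathcal{X}_t,\ g_t(x_t,x_{t-1})\le 0,\ A_tx_t+B_tx_{t-1}=b_t,\ t=1,\ldots,T,$$ with $x_0$ given, and suppose the following hold for $t=1,\ldots,T$, where $\mathcal{X}_0:=\{x_0\}$ and $\mathcal{X}_{t}^{\varepsilon}:=\mathcal{X}_{t}+\varepsilon\mathbb{B}_n$ ($\mathbb{B}_n$ the closed unit ball of $\mathbb{R}^n$): (a) $\mathcal{X}_t\subset\mathbb{R}^n$ is nonempty, convex, and compact; (b) $f_t$ is proper, convex, and lower semicontinuous; (c) each component $g_{t,i}$, $i=1,\ldots,p$, of $g_t$ is convex and lower semicontinuous; (d) there exists $\varepsilon>0$ such that $\mathcal{X}_t\times\mathcal{X}_{t-1}^{\varepsilon}\subset\mathrm{dom}(f_t)$ and for every $x_{t-1}\in\mathcal{X}_{t-1}^{\varepsilon}$ there exists $x_t\in\mathcal{X}_t$ with $g_t(x_t,x_{t-1})\le 0$ and $A_tx_t+B_tx_{t-1}=b_t$; (e) if $t\ge 2$, there exists $(\bar x_{t,t},\bar x_{t,t-1})\in\big(\mathrm{ri}(\mathcal{X}_t)\times\mathcal{X}_{t-1}\big)\cap\mathrm{ri}(\{g_t\le 0\})$ with $g_t(\bar x_{t,t},\bar x_{t,t-1})\le 0$ and $A_t\bar x_{t,t}+B_t\bar x_{t,t-1}=b_t$. Apply to $(P)$ the Dual Dynamic Programming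 (DDP) algorithm with cut selection described in the context, with a cut selection strategy such that for all $t=2,\ldots,T$, all integers $k_1\ge 1$ and all $k_2\ge k_1$, $$\mathcal{Q}_t^{k_1}(x_{t-1}^{k_1})\ge\mathcal{C}_t^{k_1}(x_{t-1}^{k_1})\quad\text{and}\quad \mathcal{Q}_t^{k_2}(x_{t-1}^{j})\ge\mathcal{Q}_t^{k_1}(x_{t-1}^{j})\ \text{ for every } j=1,\ldots,k_2.$$ Let $(x_1^*,\ldots,x_T^* )\in\mathcal{X}_1\times\cdots\times\mathcal{X}_T$ be an accumulation point of the sequence $(x_1^k,\ldots,x_T^k)_{k\ge1}$ generated by the algorithm, and let $K$ be an infinite set of integers such that $\lim_{k\to+\infty,\,k\in K}x_t^k=x_t^*$ for $t=1,\ldots,T$. Then: (i) for all $k\ge 1$, $\mathcal{Q}_{T+1}(x_T^k)=\mathcal{Q}_{T+1}^k(x_T^k)$ and $$\mathcal{Q}_T(x_{T-1}^k)=\mathcal{Q}_T^k(x_{T-1}^k)=\underline{\mathcal{Q}}_T^k(x_{T-1}^k),$$ and for $t=2,\ldots,T-1$, $$\lim_{k\to+\infty,\,k\in K}\mathcal{Q}_t^k(x_{t-1}^k)=\lim_{k\to+\infty,\,k\in K}\underline{\mathcal{Q}}_t^k(x_{t-1}^k)=\mathcal{Q}_t(x_{t-1}^* );$$ (ii) setting $\underline{\mathcal{Q}}_k=\sup_{1\le n\le k}\underline{\mathcal{Q}}_1^n(x_0)$, one has $\lim_{k\to\infty}\underline{\mathcal{Q}}_k=\mathcal{Q}_1(x_0)$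 (the limit being over the whole sequence), and $(x_1^*,\ldots,x_T^* )$ is an optimal solution of $(P)$.
   Context: Data. $T\ge2$ is an integer, $x_0\in\mathbb{R}^n$ is given, $f_t:\mathbb{R}^n\times\mathbb{R}^n\to\mathbb{R}\cup\{+\infty\}$, $g_t=(g_{t,1},\ldots,g_{t,p})$ with $g_{t,i}:\mathbb{R}^n\times\mathbb{R}^n\to\mathbb{R}\cup\{+\infty\}$, and $A_t,B_t,b_t$ are matrices and vectors of compatible sizes. $\mathrm{ri}$ denotes relative interior and $\mathrm{dom}(f)$ the set where $f$ is finite. Cost-to-go functions. $\mathcal{Q}_{T+1}\equiv0$ and, for $t=T,\ldots,1$, $$\mathcal{Q}_t(x_{t-1})=\inf_{x_t}\{f_t(x_t,x_{t-1})+\mathcal{Q}_{t+1}(x_t):\ x_t\in\mathcal{X}_t,\ g_t(x_t,x_{t-1})\le0,\ A_tx_t+B_tx_{t-1}=b_t\}.$$ DDP algorithm with cut selection. The algorithm builds functions $\mathcal{Q}_t^k$, $k=0,1,2,\ldots$. For $t=T+1$, $\mathcal{Q}_{T+1}^k\equiv0$ for all $k\ge 0$. For $t=2,\ldots,T$, $\mathcal{S}_t^0=\{0\}$ and $\mathcal{Q}_t^0=\mathcal{C}_t^0\equiv-\infty$. At iteration $k\ge1$, given $\mathcal{Q}_t^{k-1}$, define for $t=1,\ldots,T$ and $x_{t-1}\in\mathbb{R}^n$ $$\underline{\mathcal{Q}}_t^k(x_{t-1})=\inf_{x}\{f_t(x,x_{t-1})+\mathcal{Q}_{t+1}^{k-1}(x):\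 x\in\mathcal{X}_t,\ g_t(x,x_{t-1})\le0,\ A_tx+B_tx_{t-1}=b_t\}.$$ Starting from $x_0^k=x_0$, compute successively for $t=1,\ldots,T$ an (arbitrary) optimal solution $x_t^k$ of the problem defining $\underline{\mathcal{Q}}_t^k(x_{t-1}^k)$ (if $\mathcal{Q}_{t+1}^{k-1}\equiv-\infty$, any feasible point is optimal). For $t=2,\ldots,T$, set $\theta_t^k=\underline{\mathcal{Q}}_t^k(x_{t-1}^k)$, take an (arbitrary) $\beta_t^k\in\partial\underline{\mathcal{Q}}_t^k(x_{t-1}^k)$, and define the cut $$\mathcal{C}_t^k(x_{t-1})=\theta_t^k+\langle\beta_t^k,x_{t-1}-x_{t-1}^k\rangle,$$ with the convention that $\mathcal{C}_t^k\equiv-\infty$ if $\theta_t^k=-\infty$. Then the cut selection strategy chooses a set $\mathcal{S}_t^k\subset\{0,1,\ldots,k\}$ of selected cuts and $$\mathcal{Q}_t^k(x_{t-1})=\max_{\ell\in\mathcal{S}_t^k}\mathcal{C}_t^\ell(x_{t-1}).$$ *)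

theory Defs
  imports "HOL-Analysis.Analysis"
begin

section \<open>Extended-real-valued convex functions\<close>

definition edom :: "('a \<Rightarrow> ereal) \<Rightarrow> 'a set" where
  "edom f = {z. \<bar>f z\<bar> \<noteq> \<infinity>}"

definition proper_ereal :: "('a \<Rightarrow> ereal) \<Rightarrow> bool" where
  "proper_ereal f \<longleftrightarrow> (\<forall>z. f z \<noteq> -\<infinity>) \<and> (\<exists>z. f z \<noteq> \<infinity>)"

text \<open>To be used only for functions that do not take the value \<open>-\<infinity>\<close>.  The weights 0 and 1 are
  harmless, since \<open>0 * \<infinity> = 0\<close> in \<^typ>\<open>ereal\<close>.\<close>

definition convex_ereal :: "('a::real_vector \<Rightarrow> ereal) \<Rightarrow> bool" where
  "convex_ereal f \<longleftrightarrow>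
     (\<forall>y z u v. 0 \<le> u \<and> 0 \<le> v \<and> u + v = 1 \<longrightarrow>
        f (u *\<^sub>R y + v *\<^sub>R z) \<le> ereal u * f y + ereal v * f z)"

definition lsc_ereal :: "('a::topological_space \<Rightarrow> ereal) \<Rightarrow> bool" where
  "lsc_ereal f \<longleftrightarrow> (\<forall>z. f z \<le> Liminf (at z) f)"

text \<open>Where \<open>f y = -\<infinity>\<close> every vector is a subgradient.\<close>

definition subdifferential :: "('a::real_inner \<Rightarrow> ereal) \<Rightarrow> 'a \<Rightarrow> 'a set" where
  "subdifferential f y =
     {s. f y \<noteq> \<infinity> \<and> (\<forall>z. f z \<ge> f y + ereal (s \<bullet> (z - y)))}"

definition enlargement :: "'a::real_normed_vector set \<Rightarrow> real \<Rightarrow> 'a set" where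
  "enlargement X e = {x + e *\<^sub>R u | x u. x \<in> X \<and> u \<in> cball 0 1}"


section \<open>The multistage problem\<close>

text \<open>In pairs \<open>(x, y)\<close> the first component is the decision of stage \<open>t\<close> and the second one the
  decision of stage \<open>t - 1\<close>.  The matrices \<open>A\<^sub>t\<close> and \<open>B\<^sub>t\<close> have \<open>q t\<close> rows, a number that may
  depend on \<open>t\<close>; they are given by these rows, so that \<open>A t i \<bullet> x\<close> is the \<open>i\<close>-th component of the
  product of \<open>A\<^sub>t\<close> and \<open>x\<close>.\<close>

definition ineq_constraint ::
    "nat \<Rightarrow> (nat \<Rightarrow> nat \<Rightarrow> 'a \<times> 'a \<Rightarrow> ereal) \<Rightarrow> nat \<Rightarrow> 'a \<Rightarrow> 'a \<Rightarrow> bool" where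
  "ineq_constraint p g t x y \<longleftrightarrow> (\<forall>i\<in>{1..p}. g t i (x, y) \<le> 0)"

definition eq_constraint ::
    "(nat \<Rightarrow> nat) \<Rightarrow> (nat \<Rightarrow> nat \<Rightarrow> 'a::real_inner) \<Rightarrow> (nat \<Rightarrow> nat \<Rightarrow> 'a) \<Rightarrow>
     (nat \<Rightarrow> nat \<Rightarrow> real) \<Rightarrow> nat \<Rightarrow> 'a \<Rightarrow> 'a \<Rightarrow> bool" where
  "eq_constraint q A B b t x y \<longleftrightarrow> (\<forall>i\<in>{1..q t}. A t i \<bullet> x + B t i \<bullet> y = b t i)"

definition stage_feasible ::
    "(nat \<Rightarrow> 'a set) \<Rightarrow> nat \<Rightarrow> (nat \<Rightarrow> nat \<Rightarrow> 'a \<times> 'a \<Rightarrow> ereal) \<Rightarrow>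
     (nat \<Rightarrow> nat) \<Rightarrow> (nat \<Rightarrow> nat \<Rightarrow> 'a::real_inner) \<Rightarrow> (nat \<Rightarrow> nat \<Rightarrow> 'a) \<Rightarrow>
     (nat \<Rightarrow> nat \<Rightarrow> real) \<Rightarrow> nat \<Rightarrow> 'a \<Rightarrow> 'a set" where
  "stage_feasible X p g q A B b t y =
     {x \<in> X t. ineq_constraint p g t x y \<and> eq_constraint q A B b t x y}"

text \<open>Below, \<open>\<Gamma> t y\<close> is the feasible set of stage \<open>t\<close> given the previous decision \<open>y\<close>.  A
  trajectory \<open>\<xi>\<close> carries the initial state at index 0; only \<open>\<xi> 0, \<dots>, \<xi> T\<close> matter.\<close>

definition feasible_trajectory ::
    "nat \<Rightarrow> 'a \<Rightarrow> (nat \<Rightarrow> 'a \<Rightarrow> 'a set) \<Rightarrow> (nat \<Rightarrow> 'a) \<Rightarrow> bool" where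
  "feasible_trajectory T x0 \<Gamma> \<xi> \<longleftrightarrow> \<xi> 0 = x0 \<and> (\<forall>t\<in>{1..T}. \<xi> t \<in> \<Gamma> t (\<xi> (t - 1)))"

definition total_cost :: "nat \<Rightarrow> (nat \<Rightarrow> 'a \<times> 'a \<Rightarrow> ereal) \<Rightarrow> (nat \<Rightarrow> 'a) \<Rightarrow> ereal" where
  "total_cost T f \<xi> = (\<Sum>t=1..T. f t (\<xi> t, \<xi> (t - 1)))"

definition optimal_trajectory ::
    "nat \<Rightarrow> 'a \<Rightarrow> (nat \<Rightarrow> 'a \<times> 'a \<Rightarrow> ereal) \<Rightarrow> (nat \<Rightarrow> 'a \<Rightarrow> 'a set) \<Rightarrow> (nat \<Rightarrow> 'a) \<Rightarrow> bool" where
  "optimal_trajectory T x0 f \<Gamma> \<xi> \<longleftrightarrow>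
     is_arg_min (total_cost T f) (feasible_trajectory T x0 \<Gamma>) \<xi>"

text \<open>The infimum over an empty feasible set is \<open>\<infinity>\<close>, and \<open>\<infinity> + -\<infinity> = \<infinity>\<close> in \<^typ>\<open>ereal\<close>, so
  points outside the domain of \<open>f t\<close> are never preferred, even if \<open>V\<close> is \<open>-\<infinity>\<close>.\<close>

definition stage_value ::
    "(nat \<Rightarrow> 'a \<times> 'a \<Rightarrow> ereal) \<Rightarrow> (nat \<Rightarrow> 'a \<Rightarrow> 'a set) \<Rightarrow> nat \<Rightarrow> ('a \<Rightarrow> ereal) \<Rightarrow> 'a \<Rightarrow> ereal" where
  "stage_value f \<Gamma> t V y = (INF x\<in>\<Gamma> t y. f t (x, y) + V x)"

function cost_to_go ::
    "nat \<Rightarrow> (nat \<Rightarrow> 'a \<times> 'a \<Rightarrow> ereal) \<Rightarrow> (nat \<Rightarrow> 'a \<Rightarrow> 'a set) \<Rightarrow> nat \<Rightarrow> 'a \<Rightarrow> ereal" where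
  "cost_to_go T f \<Gamma> t =
     (if T < t then (\<lambda>_. 0) else stage_value f \<Gamma> t (cost_to_go T f \<Gamma> (Suc t)))"
  by auto
termination
  by (relation "Wellfounded.measure (\<lambda>(T, f, \<Gamma>, t). Suc T - t)") auto

declare cost_to_go.simps [simp del]


section \<open>Dual dynamic programming with cut selection\<close>

text \<open>In \<open>x t k\<close>, \<open>\<beta> t k\<close>, \<open>S t k\<close>, \<open>C t k\<close>, \<open>Q t k\<close> the first index is the stage and the second
  one the iteration.  \<open>lower_value f \<Gamma> Q t k\<close> is the function usually written as an underlined
  \<open>Q\<close>; it is built from the approximation of the next stage available after iteration
  \<open>k - 1\<close> and is meant for \<open>k \<ge> 1\<close> only.\<close>

definition lower_value ::
    "(nat \<Rightarrow> 'a \<times> 'a \<Rightarrow> ereal) \<Rightarrow> (nat \<Rightarrow> 'a \<Rightarrow> 'a set) \<Rightarrow> (nat \<Rightarrow> nat \<Rightarrow> 'a \<Rightarrow> ereal) \<Rightarrow>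
     nat \<Rightarrow> nat \<Rightarrow> 'a \<Rightarrow> ereal" where
  "lower_value f \<Gamma> Q t k = stage_value f \<Gamma> t (Q (t + 1) (k - 1))"

text \<open>The predicate holds if the sequences can be produced by the algorithm; the optimal solutions
  \<open>x t k\<close>, the subgradients \<open>\<beta> t k\<close> and the selected sets \<open>S t k\<close> are arbitrary choices.
  A cut with \<open>\<theta> = -\<infinity>\<close> is identically \<open>-\<infinity>\<close>, because \<open>-\<infinity> + ereal r = -\<infinity>\<close>.\<close>

definition ddp_run ::
    "nat \<Rightarrow> 'a::real_inner \<Rightarrow> (nat \<Rightarrow> 'a \<times> 'a \<Rightarrow> ereal) \<Rightarrow> (nat \<Rightarrow> 'a \<Rightarrow> 'a set) \<Rightarrow>
     (nat \<Rightarrow> nat \<Rightarrow> 'a) \<Rightarrow> (nat \<Rightarrow> nat \<Rightarrow> 'a) \<Rightarrow> (nat \<Rightarrow> nat \<Rightarrow> nat set) \<Rightarrow>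
     (nat \<Rightarrow> nat \<Rightarrow> 'a \<Rightarrow> ereal) \<Rightarrow> (nat \<Rightarrow> nat \<Rightarrow> 'a \<Rightarrow> ereal) \<Rightarrow> bool" where
  "ddp_run T x0 f \<Gamma> x \<beta> S C Q \<longleftrightarrow>
     (\<forall>k y. Q (T + 1) k y = 0) \<and>
     (\<forall>t\<in>{2..T}. S t 0 = {0} \<and> (\<forall>y. C t 0 y = -\<infinity> \<and> Q t 0 y = -\<infinity>)) \<and>
     (\<forall>k\<ge>1. x 0 k = x0 \<and>
        (\<forall>t\<in>{1..T}.
           is_arg_min (\<lambda>z. f t (z, x (t - 1) k) + Q (t + 1) (k - 1) z)
             (\<lambda>z. z \<in> \<Gamma> t (x (t - 1) k)) (x t k)) \<and>
        (\<forall>t\<in>{2..T}.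
           (let \<theta> = lower_value f \<Gamma> Q t k (x (t - 1) k) in
              \<beta> t k \<in> subdifferential (lower_value f \<Gamma> Q t k) (x (t - 1) k) \<and>
              (\<forall>y. C t k y = \<theta> + ereal (\<beta> t k \<bullet> (y - x (t - 1) k)))) \<and>
           S t k \<subseteq> {0..k} \<and> S t k \<noteq> {} \<and>
           (\<forall>y. Q t k y = Max ((\<lambda>l. C t l y) ` S t k))))"

end

theory Submission
  imports Defs
begin

text \<open>By backward induction on the stage, the cost-to-go functions are convex and finite near the
  compact sets of trial points, hence continuous and bounded above there; this bounds the slopes of
  all finite cuts.  The approximations are therefore uniformly Lipschitz.  Since they do not decrease
  at past trial points, and the trial points converge along \<open>K\<close>, the accuracy reached by stage
  \<open>t + 1\<close> at an old trial point carries over to the current one and from there to stage \<open>t\<close>.\<close>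

section \<open>Extended-real-valued convex and lower semicontinuous functions\<close>

text \<open>The slope bound cannot stand alone. A cut below \<open>V t\<close> is forced to be flat
  only if its value at its own trial point is not too low, and that value is an optimal value of
  \<open>f t\<close> plus the approximation of stage \<open>t + 1\<close>. So the latter must be
  bounded below independently of the iteration, although cut selection may make it decrease. The
  Lipschitz bound and the lower bound therefore go through one common induction.

  A second obstacle are the early iterations, where approximations are identically -\<infinity>.
  Bounds are therefore alternatives (-\<infinity> or at least a real constant), and Lipschitz
  estimates are additive inequalities in which nothing is subtracted.

  Finally there is a lag: stage \<open>t\<close> at iteration \<open>k\<close> uses
  \<open>Q (t + 1) (k - 1)\<close>, and \<open>k - 1\<close> need not lie in \<open>K\<close>. Only
  the comparison with an older index of \<open>K\<close> bridges this.\<close>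

lemma lsc_ereal_eventually_gt:
  assumes "lsc_ereal f" "a < f z"
  shows "\<forall>\<^sub>F w in nhds z. a < f w"
proof -
  have "a < Liminf (at z) f"
    using assms by (auto simp: lsc_ereal_def intro: less_le_trans)
  then have "\<forall>\<^sub>F w in at z. a < f w"
    by (rule less_LiminfD)
  then show ?thesis
    using assms(2) by (auto simp: eventually_at_filter elim: eventually_mono)
qed

text \<open>A level strictly between \<open>c0\<close> and \<open>f z\<close> would eventually
  separate \<open>f (w k)\<close> from \<open>c k\<close>. The bound varies with \<open>k\<close> so
  that one statement serves three purposes: bounds tending to -\<infinity>, constant bounds for
  sublevel sets, and convergent bounds for the optimality of the limit.\<close>

lemma lsc_ereal_le_of_tendsto:
  assumes "lsc_ereal f" "F \<noteq> bot" "(w \<longlongrightarrow> z) F" "(c \<longlongrightarrow> c0) F"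
    and "\<forall>\<^sub>F k in F. f (w k) \<le> c k"
  shows "f z \<le> c0"
proof (rule ccontr)
  assume "\<not> f z \<le> c0"
  then obtain a where a: "c0 < a" "a < f z"
    using dense[of c0 "f z"] by (auto simp: not_le)
  have "\<forall>\<^sub>F k in F. a < f (w k)"
    using lsc_ereal_eventually_gt[OF assms(1) a(2)] assms(3) by (rule eventually_compose_filterlim)
  moreover have "\<forall>\<^sub>F k in F. c k < a"
    using assms(4) a(1) by (rule order_tendstoD)
  ultimately have "\<forall>\<^sub>F k in F. False"
    using assms(5) by eventually_elim auto
  with assms(2) show False by simp
qed

lemma lsc_ereal_bounded_below:
  fixes f :: "'a::metric_space \<Rightarrow> ereal"
  assumes "lsc_ereal f" "\<And>z. f z \<noteq> -\<infinity>" "compact S"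
  shows "\<exists>m::real. \<forall>z\<in>S. ereal m \<le> f z"
proof (rule ccontr)
  assume "\<not> ?thesis"
  then have "\<forall>n. \<exists>z\<in>S. f z < ereal (- real n)"
    by (meson not_le)
  then obtain w where w: "\<And>n. w n \<in> S" "\<And>n. f (w n) < ereal (- real n)"
    by metis
  obtain l r where l: "l \<in> S" "strict_mono r" "(w \<circ> r) \<longlonglongrightarrow> l"
    using assms(3) w(1) by (meson compact_def)
  have "(\<lambda>n. ereal (- real (r n))) \<longlonglongrightarrow> -\<infinity>"
    unfolding tendsto_MInfty
  proof
    fix B :: real
    have "- real (r n) < B" if "n \<ge> nat \<lceil>- B\<rceil> + 1" for n
      using that seq_suble[OF l(2), of n] by linarith
    then show "\<forall>\<^sub>F n in sequentially. ereal (- real (r n)) < ereal B"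
      by (auto intro: eventually_sequentiallyI)
  qed
  then have "f l \<le> -\<infinity>"
    using l(3) w(2) by (intro lsc_ereal_le_of_tendsto[OF assms(1) _ l(3)[unfolded o_def]])
      (auto intro!: always_eventually less_imp_le)
  with assms(2) show False by simp
qed

lemma lsc_ereal_closed_sublevel:
  fixes f :: "'a::metric_space \<Rightarrow> ereal"
  assumes "lsc_ereal f"
  shows "closed {z. f z \<le> c}"
  unfolding closed_sequential_limits
proof (intro allI impI)
  fix w l assume "(\<forall>n. w n \<in> {z. f z \<le> c}) \<and> w \<longlonglongrightarrow> l"
  then have "f l \<le> c"
    by (intro lsc_ereal_le_of_tendsto[OF assms, of sequentially w]) auto
  then show "l \<in> {z. f z \<le> c}" by simp
qed

lemma convex_ereal_sublevel:
  assumes "convex_ereal f" "f y \<le> 0" "f z \<le> 0" "0 \<le> u" "0 \<le> v" "u + v = 1"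
  shows "f (u *\<^sub>R y + v *\<^sub>R z) \<le> 0"
proof -
  have "ereal u * f y \<le> ereal u * 0" "ereal v * f z \<le> ereal v * 0"
    using ereal_mult_left_mono[OF assms(2), of "ereal u"]
      ereal_mult_left_mono[OF assms(3), of "ereal v"] assms by simp_all
  then have "ereal u * f y + ereal v * f z \<le> 0 + 0"
    by (intro add_mono) auto
  moreover have "f (u *\<^sub>R y + v *\<^sub>R z) \<le> ereal u * f y + ereal v * f z"
    using assms unfolding convex_ereal_def by blast
  ultimately show ?thesis by simp
qed

lemma enlargement_memI:
  assumes "y \<in> Y" "norm h \<le> e" "0 < e"
  shows "y + h \<in> enlargement Y e"
  unfolding enlargement_def using assms
  by (intro CollectI exI[of _ y] exI[of _ "h /\<^sub>R e"]) (auto simp: field_simps)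

section \<open>Stage values and cost-to-go functions\<close>

lemma less_stage_valueD:
  assumes "stage_value f \<Gamma> t V y < c"
  obtains x where "x \<in> \<Gamma> t y" "f t (x, y) + V x < c"
  using assms unfolding stage_value_def INF_less_iff by auto

lemma stage_value_le: "x \<in> \<Gamma> t y \<Longrightarrow> stage_value f \<Gamma> t V y \<le> f t (x, y) + V x"
  unfolding stage_value_def by (rule INF_lower)

lemma stage_value_mono:
  "(\<And>x. V x \<le> W x) \<Longrightarrow> stage_value f \<Gamma> t V y \<le> stage_value f \<Gamma> t W y"
  unfolding stage_value_def by (intro INF_superset_mono order_refl add_left_mono)

text \<open>Partial minimization of a jointly convex function over a convex graph. Attainment of the
  infimum is not assumed, so near-optimal points for \<open>y\<close> and \<open>z\<close> are
  combined.\<close>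

lemma convex_ereal_stage_value:
  assumes "convex_ereal (f t)" "convex_ereal V"
    and f: "\<And>z. f t z \<noteq> -\<infinity>" and V: "\<And>z. V z \<noteq> -\<infinity>"
    and stage: "\<And>y. stage_value f \<Gamma> t V y \<noteq> -\<infinity>"
    and graph: "convex {(x, y). x \<in> \<Gamma> t y}"
  shows "convex_ereal (stage_value f \<Gamma> t V)"
  unfolding convex_ereal_def
proof (intro allI impI, elim conjE)
  fix y z and u v :: real
  let ?S = "stage_value f \<Gamma> t V"
  assume uv: "0 \<le> u" "0 \<le> v" "u + v = 1"
  show "?S (u *\<^sub>R y + v *\<^sub>R z) \<le> ereal u * ?S y + ereal v * ?S z"
  \<comment> \<open>A zero weight or an infinite value is settled by arithmetic in
    \<open>ereal\<close> (with 0 * \<infinity> = 0); near-optimal points within a real tolerance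
    exist only for finite values.\<close>
  proof (cases "u = 0 \<or> v = 0 \<or> ?S y = \<infinity> \<or> ?S z = \<infinity>")
    case True
    then show ?thesis
      using uv stage[of y] stage[of z]
      by (cases "?S y"; cases "?S z"; cases "u = 0"; cases "v = 0")
        (auto simp: zero_ereal_def[symmetric] one_ereal_def[symmetric])
  next
    case False
    with uv have pos: "0 < u" "0 < v" by auto
    obtain a where a: "?S y = ereal a" using False stage[of y] by (cases "?S y") auto
    obtain c where c: "?S z = ereal c" using False stage[of z] by (cases "?S z") auto
    show ?thesis
    proof (rule ereal_le_epsilon2)
      fix e :: real assume e: "0 < e"
      obtain x1 where x1: "x1 \<in> \<Gamma> t y" "f t (x1, y) + V x1 < ereal (a + e)"
        by (rule less_stage_valueD[of f \<Gamma> t V y "ereal (a + e)"]) (use a e in auto)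
      obtain x2 where x2: "x2 \<in> \<Gamma> t z" "f t (x2, z) + V x2 < ereal (c + e)"
        by (rule less_stage_valueD[of f \<Gamma> t V z "ereal (c + e)"]) (use c e in auto)
      obtain f1 v1 where 1: "f t (x1, y) = ereal f1" "V x1 = ereal v1"
        using x1(2) f[of "(x1, y)"] V[of x1] by (cases "f t (x1, y)"; cases "V x1") auto
      obtain f2 v2 where 2: "f t (x2, z) = ereal f2" "V x2 = ereal v2"
        using x2(2) f[of "(x2, z)"] V[of x2] by (cases "f t (x2, z)"; cases "V x2") auto
      let ?x = "u *\<^sub>R x1 + v *\<^sub>R x2" and ?y = "u *\<^sub>R y + v *\<^sub>R z"
      have "u *\<^sub>R (x1, y) + v *\<^sub>R (x2, z) \<in> {(x, y). x \<in> \<Gamma> t y}"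
        using x1(1) x2(1) uv by (intro convexD[OF graph]) auto
      then have "?S ?y \<le> f t (?x, ?y) + V ?x"
        by (intro stage_value_le) simp
      also have "\<dots> \<le> (ereal u * f t (x1, y) + ereal v * f t (x2, z))
          + (ereal u * V x1 + ereal v * V x2)"
      proof (intro add_mono)
        have "f t (u *\<^sub>R (x1, y) + v *\<^sub>R (x2, z)) \<le> ereal u * f t (x1, y) + ereal v * f t (x2, z)"
          using assms(1) uv unfolding convex_ereal_def by blast
        then show "f t (?x, ?y) \<le> ereal u * f t (x1, y) + ereal v * f t (x2, z)"
          by simp
        show "V ?x \<le> ereal u * V x1 + ereal v * V x2"
          using assms(2) uv unfolding convex_ereal_def by blast
      qed
      also have "\<dots> = ereal (u * (f1 + v1) + v * (f2 + v2))"
        by (simp add: 1 2 algebra_simps)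
      also have "\<dots> \<le> ereal (u * (a + e) + v * (c + e))"
      proof -
        have "f1 + v1 \<le> a + e" "f2 + v2 \<le> c + e"
          using x1(2) x2(2) by (simp_all add: 1 2)
        then have "u * (f1 + v1) \<le> u * (a + e)" "v * (f2 + v2) \<le> v * (c + e)"
          using uv by (simp_all only: mult_left_mono)
        then show ?thesis by simp
      qed
      also have "\<dots> = ereal u * ?S y + ereal v * ?S z + ereal e"
      proof -
        have "u * (a + e) + v * (c + e) = u * a + v * c + (u + v) * e"
          by (simp add: algebra_simps)
        then show ?thesis by (simp add: a c uv(3))
      qed
      finally show "?S ?y \<le> ereal u * ?S y + ereal v * ?S z + ereal e" .
    qed
  qed
qed

text \<open>A finite convex function on an open convex set of a Euclidean space is continuous. The
  open neighbourhood \<open>N\<close> of \<open>Y\<close> is such a set; the compact neighbourhood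
  \<open>D\<close> of half the radius lies inside \<open>N\<close> and yields the upper bound beyond
  \<open>Y\<close> itself.\<close>

lemma convex_ereal_continuous_near:
  fixes V :: "'a::euclidean_space \<Rightarrow> ereal"
  assumes V: "convex_ereal V" and Y: "convex Y" "compact Y"
    and e: "0 < e" and fin: "\<And>y. y \<in> enlargement Y e \<Longrightarrow> \<bar>V y\<bar> \<noteq> \<infinity>"
  shows "continuous_on Y V"
    and "\<exists>d>0. \<exists>M. \<forall>y\<in>Y. \<forall>h. norm h \<le> d \<longrightarrow> V (y + h) \<le> ereal M"
proof -
  define N where "N = (\<Union>y\<in>Y. \<Union>h\<in>ball 0 e. {y + h})"
  define r where "r = (\<lambda>y. real_of_ereal (V y))"
  have Vr: "V y = ereal (r y)" if "y \<in> N" for y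
    using that e unfolding r_def N_def
    by (auto intro!: ereal_real'[symmetric] fin enlargement_memI)
  have "open N" unfolding N_def by (auto intro: open_sums)
  have "convex N" unfolding N_def by (intro convex_sums Y convex_ball)
  have "convex_on N r"
  proof (rule convex_onI)
    fix s :: real and y z assume s: "0 < s" "s < 1" and yz: "y \<in> N" "z \<in> N"
    have "(1 - s) *\<^sub>R y + s *\<^sub>R z \<in> N"
      using s yz \<open>convex N\<close> by (intro convexD) auto
    moreover have "V ((1 - s) *\<^sub>R y + s *\<^sub>R z) \<le> ereal (1 - s) * V y + ereal s * V z"
      using V s unfolding convex_ereal_def by (metis diff_ge_0_iff_ge less_imp_le diff_add_cancel)
    ultimately show "r ((1 - s) *\<^sub>R y + s *\<^sub>R z) \<le> (1 - s) * r y + s * r z"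
      using yz by (simp add: Vr)
  qed (fact \<open>convex N\<close>)
  then have cont: "continuous_on N r"
    using \<open>open N\<close> by (rule convex_on_continuous[rotated])
  have sub: "Y \<subseteq> N" using e by (force simp: N_def)
  then show "continuous_on Y V"
    using continuous_on_ereal[OF continuous_on_subset[OF cont sub]] Vr
    by (subst continuous_on_cong[of Y Y V "\<lambda>y. ereal (r y)"]) auto
  define D where "D = (\<Union>y\<in>Y. \<Union>h\<in>cball 0 (e/2). {y + h})"
  have "compact D" unfolding D_def by (intro compact_sums' Y compact_cball)
  moreover have "D \<subseteq> N" using e by (force simp: D_def N_def)
  ultimately have "compact (r ` D)"
    using cont by (intro compact_continuous_image continuous_on_subset[OF cont])
  then obtain M where M: "\<And>y. y \<in> D \<Longrightarrow> r y \<le> M"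
    using bounded_imp_bdd_above[OF compact_imp_bounded] by (metis bdd_above.E imageI)
  have "V (y + h) \<le> ereal M" if "y \<in> Y" "norm h \<le> e/2" for y h
  proof -
    have "y + h \<in> D"
      unfolding D_def using that by (intro UN_I[of y] UN_I[of h]) auto
    then show ?thesis using M[of "y + h"] Vr[of "y + h"] \<open>D \<subseteq> N\<close> by auto
  qed
  then show "\<exists>d>0. \<exists>M. \<forall>y\<in>Y. \<forall>h. norm h \<le> d \<longrightarrow> V (y + h) \<le> ereal M"
    using e by (intro exI[of _ "e/2"]) auto
qed

text \<open>Constraints enter only through the set-valued map \<open>\<Gamma>\<close>. Convexity of
  its graph makes the cost-to-go functions convex, closedness keeps limits of feasible pairs
  feasible, and \<open>recourse\<close> gives finiteness on a neighbourhood of the previous stage's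
  set.\<close>

locale multistage =
  fixes T :: nat and x0 :: "'a::euclidean_space" and X :: "nat \<Rightarrow> 'a set"
    and f :: "nat \<Rightarrow> 'a \<times> 'a \<Rightarrow> ereal" and \<Gamma> :: "nat \<Rightarrow> 'a \<Rightarrow> 'a set"
  assumes X0: "X 0 = {x0}"
    and X_compact_convex: "t \<in> {1..T} \<Longrightarrow> X t \<noteq> {} \<and> convex (X t) \<and> compact (X t)"
    and f_convex_lsc: "t \<in> {1..T} \<Longrightarrow> proper_ereal (f t) \<and> convex_ereal (f t) \<and> lsc_ereal (f t)"
    and \<Gamma>_subset: "\<Gamma> t y \<subseteq> X t"
    and \<Gamma>_convex: "t \<in> {1..T} \<Longrightarrow> convex {(x, y). x \<in> \<Gamma> t y}"
    and \<Gamma>_closed: "t \<in> {1..T} \<Longrightarrow> closed {(x, y). x \<in> \<Gamma> t y}"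
    and recourse: "t \<in> {1..T} \<Longrightarrow> \<exists>\<epsilon>>0. X t \<times> enlargement (X (t - 1)) \<epsilon> \<subseteq> edom (f t) \<and>
      (\<forall>y\<in>enlargement (X (t - 1)) \<epsilon>. \<Gamma> t y \<noteq> {})"
begin

abbreviation "V \<equiv> cost_to_go T f \<Gamma>"

lemma V_final [simp]: "V (Suc T) = (\<lambda>_. 0)"
  by (simp add: cost_to_go.simps)

lemma V_stage: "t \<le> T \<Longrightarrow> V t = stage_value f \<Gamma> t (V (Suc t))"
  by (simp add: cost_to_go.simps[of T f \<Gamma> t])

lemma X_props: "t \<le> T \<Longrightarrow> X t \<noteq> {} \<and> convex (X t) \<and> compact (X t)"
  using X_compact_convex[of t] X0 by (cases "t = 0") auto

lemma f_nMInfty: "t \<in> {1..T} \<Longrightarrow> f t z \<noteq> -\<infinity>"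
  using f_convex_lsc[of t] unfolding proper_ereal_def by blast

text \<open>Decisions range over the compact \<open>X t\<close>, so \<open>f t\<close> is bounded
  below on \<open>X t \<times> Y\<close>. The set \<open>Y\<close> is arbitrary because the value
  -\<infinity> has to be excluded at every point of the space, through singletons.\<close>

lemma V_bounded_below:
  assumes "1 \<le> t" "t \<le> Suc T" "compact Y"
  shows "\<exists>m::real. \<forall>y\<in>Y. ereal m \<le> V t y"
  using assms(2,1,3)
proof (induction t arbitrary: Y rule: inc_induct)
  case base
  then show ?case by (auto intro!: exI[of _ 0])
next
  case (step t)
  then have t: "t \<in> {1..T}" by auto
  obtain m where m: "\<And>y. y \<in> X t \<Longrightarrow> ereal m \<le> V (Suc t) y"
    using step.IH[of "X t"] X_compact_convex[OF t] by auto
  have "compact (X t \<times> Y)"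
    using X_compact_convex[OF t] step.prems by (simp add: compact_Times)
  then obtain m' where m': "\<And>x y. x \<in> X t \<Longrightarrow> y \<in> Y \<Longrightarrow> ereal m' \<le> f t (x, y)"
    using lsc_ereal_bounded_below[of "f t" "X t \<times> Y"] f_convex_lsc[OF t] f_nMInfty[OF t] by blast
  have "ereal (m' + m) \<le> V t y" if "y \<in> Y" for y
    unfolding V_stage[OF t[simplified, THEN conjunct2]] stage_value_def plus_ereal.simps(1)[symmetric]
    using that \<Gamma>_subset[of t y] by (intro INF_greatest add_mono m m') auto
  then show ?case by blast
qed

lemma V_nMInfty: "1 \<le> t \<Longrightarrow> t \<le> Suc T \<Longrightarrow> V t y \<noteq> -\<infinity>"
  using V_bounded_below[of t "{y}"] by auto

lemma V_convex:
  assumes "1 \<le> t" "t \<le> Suc T"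
  shows "convex_ereal (V t)"
  using assms(2,1)
proof (induction t rule: inc_induct)
  case base
  then show ?case by (simp add: convex_ereal_def)
next
  case (step t)
  then have "V t = stage_value f \<Gamma> t (V (Suc t))" by (intro V_stage) simp
  with step show ?case
    using f_convex_lsc[of t] f_nMInfty[of t] \<Gamma>_convex[of t] V_nMInfty[of "Suc t"] V_nMInfty[of t]
      convex_ereal_stage_value[of f t "V (Suc t)" \<Gamma>] by simp
qed

text \<open>The radii do not accumulate over the stages: a feasible decision lies in
  \<open>X t\<close> itself, where the next cost-to-go function is finite, so the radius from
  \<open>recourse\<close> at stage \<open>t\<close> suffices.\<close>

lemma V_finite_near:
  assumes "1 \<le> t" "t \<le> Suc T"
  shows "\<exists>e>0. \<forall>y\<in>enlargement (X (t - 1)) e. \<bar>V t y\<bar> \<noteq> \<infinity>"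
  using assms(2,1)
proof (induction t rule: inc_induct)
  case base
  then show ?case by (auto intro!: exI[of _ 1])
next
  case (step t)
  then have t: "t \<in> {1..T}" by auto
  obtain e' where e': "e' > 0" "\<And>y. y \<in> enlargement (X t) e' \<Longrightarrow> \<bar>V (Suc t) y\<bar> \<noteq> \<infinity>"
    using step.IH by auto
  obtain e where e: "e > 0" "X t \<times> enlargement (X (t - 1)) e \<subseteq> edom (f t)"
    "\<And>y. y \<in> enlargement (X (t - 1)) e \<Longrightarrow> \<Gamma> t y \<noteq> {}"
    using recourse[OF t] by blast
  have "\<bar>V t y\<bar> \<noteq> \<infinity>" if y: "y \<in> enlargement (X (t - 1)) e" for y
  proof -
    obtain x where x: "x \<in> \<Gamma> t y" using e(3)[OF y] by auto
    then have "x \<in> X t" using \<Gamma>_subset by auto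
    then have "\<bar>f t (x, y)\<bar> \<noteq> \<infinity>" "\<bar>V (Suc t) x\<bar> \<noteq> \<infinity>"
      using e(2) y e'(2) enlargement_memI[of x "X t" 0 e'] e'(1) by (auto simp: edom_def)
    then have "f t (x, y) + V (Suc t) x \<noteq> \<infinity>" by auto
    moreover have "V t y \<le> f t (x, y) + V (Suc t) x"
      using stage_value_le[of x \<Gamma> t y f "V (Suc t)"] x t by (simp add: V_stage)
    ultimately show ?thesis using V_nMInfty[of t y] t by auto
  qed
  then show ?case using e(1) by (intro exI[of _ e] conjI ballI)
qed

lemma
  assumes "1 \<le> t" "t \<le> Suc T"
  shows V_continuous: "continuous_on (X (t - 1)) (V t)"
    and V_bounded_above_near:
      "\<exists>d>0. \<exists>M. \<forall>y\<in>X (t - 1). \<forall>h. norm h \<le> d \<longrightarrow> V t (y + h) \<le> ereal M"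
    and V_finite: "y \<in> X (t - 1) \<Longrightarrow> \<bar>V t y\<bar> \<noteq> \<infinity>"
proof -
  obtain e where e: "e > 0" "\<And>y. y \<in> enlargement (X (t - 1)) e \<Longrightarrow> \<bar>V t y\<bar> \<noteq> \<infinity>"
    using V_finite_near[OF assms] by auto
  have "convex (X (t - 1))" "compact (X (t - 1))"
    using X_props[of "t - 1"] assms by auto
  from convex_ereal_continuous_near[OF V_convex[OF assms] this e]
  show "continuous_on (X (t - 1)) (V t)"
    "\<exists>d>0. \<exists>M. \<forall>y\<in>X (t - 1). \<forall>h. norm h \<le> d \<longrightarrow> V t (y + h) \<le> ereal M"
    by auto
  show "\<bar>V t y\<bar> \<noteq> \<infinity>" if "y \<in> X (t - 1)"
    using enlargement_memI[OF that, of 0 e] e by auto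
qed

section \<open>Bellman's principle: from stagewise to global optimality\<close>

lemma cost_to_go_le_tail_cost:
  assumes "feasible_trajectory T x0 \<Gamma> \<xi>" "1 \<le> t" "t \<le> Suc T"
  shows "V t (\<xi> (t - 1)) \<le> (\<Sum>s=t..T. f s (\<xi> s, \<xi> (s - 1)))"
  using assms(3,2)
proof (induction t rule: inc_induct)
  case (step t)
  have "V t (\<xi> (t - 1)) \<le> f t (\<xi> t, \<xi> (t - 1)) + V (Suc t) (\<xi> t)"
    using assms(1) step unfolding feasible_trajectory_def
    by (subst V_stage) (auto intro!: stage_value_le)
  also have "\<dots> \<le> f t (\<xi> t, \<xi> (t - 1)) + (\<Sum>s=Suc t..T. f s (\<xi> s, \<xi> (s - 1)))"
    using step by (intro add_left_mono) simp
  also have "\<dots> = (\<Sum>s=t..T. f s (\<xi> s, \<xi> (s - 1)))"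
    using step by (subst sum.atLeast_Suc_atMost) auto
  finally show ?case .
qed simp

text \<open>The stagewise inequalities telescope. Since \<open>V 1 x0\<close> is a lower bound for
  the cost of every feasible trajectory, a feasible one satisfying them is optimal.\<close>

lemma tail_cost_le_cost_to_go:
  assumes "\<And>t. t \<in> {1..T} \<Longrightarrow> f t (\<xi> t, \<xi> (t - 1)) + V (Suc t) (\<xi> t) \<le> V t (\<xi> (t - 1))"
    and "1 \<le> t" "t \<le> Suc T"
  shows "(\<Sum>s=t..T. f s (\<xi> s, \<xi> (s - 1))) \<le> V t (\<xi> (t - 1))"
  using assms(3,2)
proof (induction t rule: inc_induct)
  case (step t)
  have "(\<Sum>s=t..T. f s (\<xi> s, \<xi> (s - 1)))
      = f t (\<xi> t, \<xi> (t - 1)) + (\<Sum>s=Suc t..T. f s (\<xi> s, \<xi> (s - 1)))"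
    using step by (subst sum.atLeast_Suc_atMost) auto
  also have "\<dots> \<le> f t (\<xi> t, \<xi> (t - 1)) + V (Suc t) (\<xi> t)"
    using step by (intro add_left_mono) simp
  also have "\<dots> \<le> V t (\<xi> (t - 1))"
    using step by (intro assms(1)) auto
  finally show ?case .
qed simp

lemma optimal_trajectoryI:
  assumes "feasible_trajectory T x0 \<Gamma> \<xi>"
    and "\<And>t. t \<in> {1..T} \<Longrightarrow> f t (\<xi> t, \<xi> (t - 1)) + V (Suc t) (\<xi> t) \<le> V t (\<xi> (t - 1))"
  shows "optimal_trajectory T x0 f \<Gamma> \<xi>"
proof -
  have "total_cost T f \<xi> \<le> total_cost T f \<eta>" if "feasible_trajectory T x0 \<Gamma> \<eta>" for \<eta>
    using tail_cost_le_cost_to_go[of \<xi> 1] cost_to_go_le_tail_cost[OF that, of 1] assms that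
    by (auto simp: total_cost_def feasible_trajectory_def)
  with assms(1) show ?thesis
    by (auto simp: optimal_trajectory_def is_arg_min_def not_less)
qed

end

section \<open>Cuts and their uniform Lipschitz bounds\<close>

locale ddp = multistage T x0 X f \<Gamma>
  for T x0 X and f :: "nat \<Rightarrow> 'a::euclidean_space \<times> 'a \<Rightarrow> ereal" and \<Gamma> +
  fixes x \<beta> :: "nat \<Rightarrow> nat \<Rightarrow> 'a" and S :: "nat \<Rightarrow> nat \<Rightarrow> nat set"
    and C Q :: "nat \<Rightarrow> nat \<Rightarrow> 'a \<Rightarrow> ereal"
  assumes T_ge_2: "T \<ge> 2"
    and run: "ddp_run T x0 f \<Gamma> x \<beta> S C Q"
    and selection: "t \<in> {2..T} \<Longrightarrow> k1 \<ge> 1 \<Longrightarrow> k2 \<ge> k1 \<Longrightarrow>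
      Q t k1 (x (t - 1) k1) \<ge> C t k1 (x (t - 1) k1) \<and>
      (\<forall>j\<in>{1..k2}. Q t k2 (x (t - 1) j) \<ge> Q t k1 (x (t - 1) j))"
begin

abbreviation "L \<equiv> lower_value f \<Gamma> Q"

lemmas run_step = run[unfolded ddp_run_def Let_def, THEN conjunct2, THEN conjunct2, THEN spec, THEN mp]

lemmas x_0 = run_step[THEN conjunct1]

lemma x_arg_min: "k \<ge> 1 \<Longrightarrow> t \<in> {1..T} \<Longrightarrow>
    is_arg_min (\<lambda>z. f t (z, x (t - 1) k) + Q (Suc t) (k - 1) z) (\<lambda>z. z \<in> \<Gamma> t (x (t - 1) k)) (x t k)"
  using run_step[THEN conjunct2, THEN conjunct1, THEN bspec] by simp

lemmas cut_step = run_step[THEN conjunct2, THEN conjunct2, THEN bspec]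

lemmas \<beta>_subdifferential = cut_step[THEN conjunct1, THEN conjunct1]

lemmas C_eq = cut_step[THEN conjunct1, THEN conjunct2, THEN spec]

lemmas run_init = run[unfolded ddp_run_def, THEN conjunct2, THEN conjunct1, THEN bspec]

lemma C_0: "t \<in> {2..T} \<Longrightarrow> C t 0 y = -\<infinity>"
  using run_init by blast

lemma Q_final [simp]: "Q (Suc T) k = (\<lambda>_. 0)"
  using run unfolding ddp_run_def by auto

lemma S_subset: "t \<in> {2..T} \<Longrightarrow> S t k \<subseteq> {0..k} \<and> S t k \<noteq> {}"
  using run_init[of t] cut_step[of k t] by (cases "k = 0") auto

lemma Q_eq_Max:
  assumes t: "t \<in> {2..T}"
  shows "Q t k y = Max ((\<lambda>l. C t l y) ` S t k)"
proof (cases "k = 0")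
  case True
  have "S t 0 = {0}" "Q t 0 y = -\<infinity>"
    using run_init[OF t] by auto
  with True C_0[OF t] show ?thesis by simp
next
  case False
  then show ?thesis using cut_step[OF _ t, of k] by simp
qed

lemma finite_S: "t \<in> {2..T} \<Longrightarrow> finite (S t k)"
  using S_subset finite_subset by blast

lemma Q_le: "t \<in> {2..T} \<Longrightarrow> (\<And>l. l \<in> S t k \<Longrightarrow> C t l y \<le> c) \<Longrightarrow> Q t k y \<le> c"
  using finite_S[of t k] S_subset[of t k] by (subst Q_eq_Max) auto

lemma C_le_Q: "t \<in> {2..T} \<Longrightarrow> l \<in> S t k \<Longrightarrow> C t l y \<le> Q t k y"
  using finite_S[of t k] by (subst Q_eq_Max) auto

lemma x_feasible: "k \<ge> 1 \<Longrightarrow> t \<in> {1..T} \<Longrightarrow> x t k \<in> \<Gamma> t (x (t - 1) k)"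
  using x_arg_min unfolding is_arg_min_def by blast

lemma x_mem: "k \<ge> 1 \<Longrightarrow> t \<le> T \<Longrightarrow> x t k \<in> X t"
  using x_feasible[of k t] \<Gamma>_subset[of t "x (t - 1) k"] x_0[of k] X0 by (cases "t = 0") auto

lemma lower_value_eq:
  "L t k y = stage_value f \<Gamma> t (Q (Suc t) (k - 1)) y"
  by (simp add: lower_value_def)

lemma lower_value_trial:
  assumes "k \<ge> 1" "t \<in> {1..T}"
  shows "L t k (x (t - 1) k) = f t (x t k, x (t - 1) k) + Q (Suc t) (k - 1) (x t k)"
proof (rule antisym)
  show "L t k (x (t - 1) k) \<le> f t (x t k, x (t - 1) k) + Q (Suc t) (k - 1) (x t k)"
    unfolding lower_value_eq by (rule stage_value_le) (rule x_feasible[OF assms])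
  show "f t (x t k, x (t - 1) k) + Q (Suc t) (k - 1) (x t k) \<le> L t k (x (t - 1) k)"
    unfolding lower_value_eq stage_value_def
    using x_arg_min[OF assms] by (intro INF_greatest) (auto simp: is_arg_min_def not_less)
qed

section \<open>Validity and tightness of the cuts\<close>

lemma C_le_lower_value: "k \<ge> 1 \<Longrightarrow> t \<in> {2..T} \<Longrightarrow> C t k y \<le> L t k y"
  using \<beta>_subdifferential[of k t] by (simp add: C_eq subdifferential_def)

text \<open>A cut minorizes the stage value of its own iteration, which is built on an underestimate
  of the next stage. It thus stays valid forever, and any selection of cuts is an
  underestimate.\<close>

lemma Q_le_V:
  assumes "2 \<le> t" "t \<le> Suc T"
  shows "Q t k y \<le> V t y"
  using assms(2,1)
proof (induction t arbitrary: k y rule: inc_induct)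
  case (step t)
  then have t: "t \<in> {2..T}" "t \<le> T" by auto
  have "C t l y \<le> V t y" for l
  proof (cases "l = 0")
    case False
    then have "C t l y \<le> L t l y" using t by (intro C_le_lower_value) auto
    also have "\<dots> \<le> V t y"
      unfolding lower_value_eq V_stage[OF t(2)] using step by (intro stage_value_mono) auto
    finally show ?thesis .
  qed (use C_0[OF t(1), of y] in simp)
  then show ?case by (intro Q_le t)
qed simp

lemma lower_value_le_V: "t \<in> {1..T} \<Longrightarrow> L t k y \<le> V t y"
  unfolding lower_value_eq by (subst V_stage) (auto intro!: stage_value_mono Q_le_V)

text \<open>At its own trial point the linear part of the new cut vanishes, leaving \<theta>; the
  first selection condition guarantees this value even if the new cut is discarded.\<close>

lemma lower_value_le_Q:
  assumes "t \<in> {2..T}" "k \<ge> 1"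
  shows "L t k (x (t - 1) k) \<le> Q t k (x (t - 1) k)"
  using selection[OF assms, of k] by (simp add: C_eq[OF assms(2,1)] flip: zero_ereal_def)

text \<open>The value is attained at the trial decision. Either the next approximation is
  -\<infinity> there, or both summands are bounded below, \<open>f t\<close> by lower semicontinuity
  on a compact product.\<close>

lemma \<theta>_bounded_below:
  assumes t: "t \<in> {2..T}"
    and m: "\<And>k. (\<forall>y. Q (Suc t) k y = -\<infinity>) \<or> (\<forall>y\<in>X t. ereal m \<le> Q (Suc t) k y)"
  shows "\<exists>m'::real. \<forall>k\<ge>1. L t k (x (t - 1) k) = -\<infinity> \<or> ereal m' \<le> L t k (x (t - 1) k)"
proof -
  have t': "t \<in> {1..T}" "t - 1 \<le> T" "t \<le> T" using t by auto
  have cpt: "compact (X t \<times> X (t - 1))" and lsc: "lsc_ereal (f t)"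
    using X_props[OF t'(2)] X_compact_convex[OF t'(1)] f_convex_lsc[OF t'(1)] by (simp_all add: compact_Times)
  obtain m' where "\<forall>z\<in>X t \<times> X (t - 1). ereal m' \<le> f t z"
    using lsc_ereal_bounded_below[OF lsc f_nMInfty[OF t'(1)] cpt] by blast
  then have m': "ereal m' \<le> f t (z, y)" if "z \<in> X t" "y \<in> X (t - 1)" for z y
    using that by blast
  \<comment> \<open>Finiteness matters because \<infinity> + -\<infinity> = \<infinity>: only a
    finite cost guarantees that an approximation equal to -\<infinity> produces the value
    -\<infinity>.\<close>
  have fin: "\<bar>f t (z, y)\<bar> \<noteq> \<infinity>" if "z \<in> X t" "y \<in> X (t - 1)" for z y
  proof -
    obtain e where "e > 0" "X t \<times> enlargement (X (t - 1)) e \<subseteq> edom (f t)"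
      using recourse[OF t'(1)] by blast
    then show ?thesis
      using that enlargement_memI[OF that(2), of 0 e] by (auto simp: edom_def)
  qed
  have "L t k (x (t - 1) k) = -\<infinity> \<or> ereal (m' + m) \<le> L t k (x (t - 1) k)" if k: "k \<ge> 1" for k
    using m[of "k - 1"]
  proof
    assume "\<forall>y. Q (Suc t) (k - 1) y = -\<infinity>"
    then show ?thesis
      unfolding lower_value_trial[OF k t'(1)] using fin[OF x_mem[OF k t'(3)] x_mem[OF k t'(2)]]
      by (cases "f t (x t k, x (t - 1) k)") auto
  next
    assume "\<forall>y\<in>X t. ereal m \<le> Q (Suc t) (k - 1) y"
    then have "ereal m' + ereal m \<le> f t (x t k, x (t - 1) k) + Q (Suc t) (k - 1) (x t k)"
      by (intro add_mono m' x_mem k t') (auto intro!: x_mem k t')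
    then show ?thesis unfolding lower_value_trial[OF k t'(1)] by simp
  qed
  then show ?thesis by blast
qed

text \<open>A cut lies below \<open>V t\<close>, which is bounded above near \<open>X (t - 1)\<close>, so a cut that is not too
  low at its trial point cannot be steep.\<close>

lemma \<beta>_bounded:
  assumes t: "t \<in> {2..T}"
    and m: "\<And>k. k \<ge> 1 \<Longrightarrow> L t k (x (t - 1) k) = -\<infinity> \<or> ereal m \<le> L t k (x (t - 1) k)"
  shows "\<exists>M\<ge>0. \<forall>k\<ge>1. L t k (x (t - 1) k) \<noteq> -\<infinity> \<longrightarrow> norm (\<beta> t k) \<le> M"
proof -
  have t': "1 \<le> t" "t \<le> Suc T" "t - 1 \<le> T" "t \<in> {1..T}" using t by auto
  obtain d u where d: "d > 0"
    and u: "\<And>y h. y \<in> X (t - 1) \<Longrightarrow> norm h \<le> d \<Longrightarrow> V t (y + h) \<le> ereal u"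
    using V_bounded_above_near[OF t'(1,2)] by blast
  have "norm (\<beta> t k) \<le> max 0 ((u - m) / d)"
    if k: "k \<ge> 1" and \<theta>: "L t k (x (t - 1) k) \<noteq> -\<infinity>" for k
  proof (cases "\<beta> t k = 0")
    case False
    \<comment> \<open>A step of length \<open>d\<close> along the slope: there the cut has risen by
      \<open>d * norm (\<beta> t k)\<close> from at least \<open>m\<close>, and it is still at most
      \<open>u\<close>.\<close>
    define h where "h = (d / norm (\<beta> t k)) *\<^sub>R \<beta> t k"
    have h: "norm h = d" "\<beta> t k \<bullet> h = d * norm (\<beta> t k)"
      using False d by (simp_all add: h_def power2_norm_eq_inner[symmetric] power2_eq_square)
    have "ereal (m + d * norm (\<beta> t k)) = ereal m + ereal (\<beta> t k \<bullet> (x (t - 1) k + h - x (t - 1) k))"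
      by (simp add: h)
    also have "\<dots> \<le> C t k (x (t - 1) k + h)"
      unfolding C_eq[OF k t] using m[OF k] \<theta> by (intro add_right_mono) auto
    also have "\<dots> \<le> V t (x (t - 1) k + h)"
      using C_le_lower_value[OF k t] lower_value_le_V[OF t'(4)] by (rule order_trans)
    also have "\<dots> \<le> ereal u"
      using h by (intro u x_mem k t') simp
    finally have "norm (\<beta> t k) \<le> (u - m) / d"
      using d by (simp add: field_simps)
    then show ?thesis by simp
  qed simp
  then show ?thesis by (intro exI[of _ "max 0 ((u - m) / d)"]) auto
qed

text \<open>A maximum of affine functions with slopes of norm at most \<open>M\<close> is
  \<open>M\<close>-Lipschitz, whichever cuts are selected. Cuts identically -\<infinity> fit the
  additive form trivially.\<close>

lemma Q_lipschitz_of_\<beta>: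
  assumes t: "t \<in> {2..T}"
    and M: "\<And>k. k \<ge> 1 \<Longrightarrow> L t k (x (t - 1) k) \<noteq> -\<infinity> \<Longrightarrow> norm (\<beta> t k) \<le> M"
  shows "Q t k y \<le> Q t k z + ereal (M * norm (y - z))"
proof (rule Q_le[OF t])
  fix l assume l: "l \<in> S t k"
  have "C t l y \<le> C t l z + ereal (M * norm (y - z))"
  proof (cases "l = 0 \<or> L t l (x (t - 1) l) = -\<infinity>")
    case True
    then show ?thesis using t by (cases "l = 0") (auto simp: C_0 C_eq)
  next
    case False
    then have l: "l \<ge> 1" by auto
    have "\<beta> t l \<bullet> (y - z) \<le> norm (\<beta> t l) * norm (y - z)" by (rule norm_cauchy_schwarz)
    also have "\<dots> \<le> M * norm (y - z)"
      using M[OF l] False by (intro mult_right_mono) auto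
    finally have "\<beta> t l \<bullet> (y - x (t - 1) l) \<le> \<beta> t l \<bullet> (z - x (t - 1) l) + M * norm (y - z)"
      by (simp add: inner_diff_right)
    then show ?thesis
      unfolding C_eq[OF l t] by (cases "L t l (x (t - 1) l)") auto
  qed
  also have "\<dots> \<le> Q t k z + ereal (M * norm (y - z))"
    by (intro add_right_mono C_le_Q t l)
  finally show "C t l y \<le> Q t k z + ereal (M * norm (y - z))" .
qed

text \<open>Cut selection may lower the approximations away from the trial points.  They stay bounded
  below nevertheless: once finite, they never decrease at one fixed trial point.\<close>

lemma Q_bounded_below_of_lipschitz:
  assumes t: "t \<in> {2..T}" and "M \<ge> 0"
    and M: "\<And>k y z. Q t k y \<le> Q t k z + ereal (M * norm (y - z))"
  shows "\<exists>m. \<forall>k. (\<forall>y. Q t k y = -\<infinity>) \<or> (\<forall>y\<in>X (t - 1). ereal m \<le> Q t k y)"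
proof -
  have t': "t - 1 \<le> T" using t by auto
  let ?\<theta> = "\<lambda>k. L t k (x (t - 1) k)"
  have Q_MInf: "\<forall>y. Q t k y = -\<infinity>" if "\<And>l. 1 \<le> l \<Longrightarrow> l \<le> k \<Longrightarrow> ?\<theta> l = -\<infinity>" for k
  proof
    fix y
    have "C t l y \<le> -\<infinity>" if "l \<in> S t k" for l
      using S_subset[OF t, of k] that \<open>\<And>l. 1 \<le> l \<Longrightarrow> l \<le> k \<Longrightarrow> ?\<theta> l = -\<infinity>\<close>[of l] t
      by (cases "l = 0") (auto simp: C_0 C_eq)
    then have "Q t k y \<le> -\<infinity>" by (rule Q_le[OF t])
    then show "Q t k y = -\<infinity>" by simp
  qed
  show ?thesis
  proof (cases "\<exists>j\<ge>1. ?\<theta> j \<noteq> -\<infinity>")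
    case False
    then show ?thesis using Q_MInf by blast
  next
    case True
    \<comment> \<open>The first iteration with a finite cut is the anchor: before it all cuts are
      -\<infinity>, and from then on the value at its trial point is at least \<theta>. The
      Lipschitz bound spreads this over \<open>X (t - 1)\<close>, whose diameter is at most
      \<open>2 * B\<close>.\<close>
    define j where "j = (LEAST j. j \<ge> 1 \<and> ?\<theta> j \<noteq> -\<infinity>)"
    have j: "j \<ge> 1" "?\<theta> j \<noteq> -\<infinity>"
      using LeastI_ex[OF True] unfolding j_def by auto
    have below: "?\<theta> l = -\<infinity>" if "1 \<le> l" "l < j" for l
      using not_less_Least[of l "\<lambda>j. j \<ge> 1 \<and> ?\<theta> j \<noteq> -\<infinity>"] that unfolding j_def by auto
    have "?\<theta> j \<noteq> \<infinity>"
      using \<beta>_subdifferential[OF j(1) t] by (simp add: subdifferential_def)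
    with j(2) obtain \<theta> where \<theta>: "?\<theta> j = ereal \<theta>" by (cases "?\<theta> j") auto
    obtain B where B: "\<And>y. y \<in> X (t - 1) \<Longrightarrow> norm y \<le> B"
      using X_props[OF t'] compact_imp_bounded[of "X (t - 1)"] by (auto simp: bounded_iff)
    have "ereal (\<theta> - M * (2 * B)) \<le> Q t k y" if "j \<le> k" "y \<in> X (t - 1)" for k y
    proof -
      let ?z = "x (t - 1) j"
      have "norm (?z - y) \<le> 2 * B"
        using norm_triangle_ineq4[of ?z y] B[OF x_mem[OF j(1) t']] B[OF that(2)] by linarith
      then have M': "M * norm (?z - y) \<le> M * (2 * B)"
        using \<open>M \<ge> 0\<close> by (rule mult_left_mono)
      have "ereal \<theta> \<le> Q t j ?z"
        using lower_value_le_Q[OF t j(1)] unfolding \<theta> .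
      also have "\<dots> \<le> Q t k ?z"
        using selection[OF t j(1) \<open>j \<le> k\<close>] j(1) \<open>j \<le> k\<close> by auto
      also have "\<dots> \<le> Q t k y + ereal (M * norm (?z - y))"
        by (rule M)
      finally show ?thesis
        using M' by (cases "Q t k y") auto
    qed
    moreover have "\<forall>y. Q t k y = -\<infinity>" if "k < j" for k
      using that by (intro Q_MInf below) auto
    ultimately show ?thesis
      by (intro exI[of _ "\<theta> - M * (2 * B)"]) (meson not_less)
  qed
qed

text \<open>Only the lower bound of the next stage is used in the induction step: it bounds the
  finite \<theta> from below, hence the slopes, hence the Lipschitz constant, and this restores the
  lower bound one stage earlier.\<close>

lemma Q_regular:
  assumes "2 \<le> t" "t \<le> Suc T"
  shows "\<exists>M m. 0 \<le> M \<and> (\<forall>k y z. Q t k y \<le> Q t k z + ereal (M * norm (y - z))) \<and>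
    (\<forall>k. (\<forall>y. Q t k y = -\<infinity>) \<or> (\<forall>y\<in>X (t - 1). ereal m \<le> Q t k y))"
  using assms(2,1)
proof (induction t rule: inc_induct)
  case base
  then show ?case by (auto intro!: exI[of _ 0])
next
  case (step t)
  then have t: "t \<in> {2..T}" by auto
  obtain m1 where "\<And>k. (\<forall>y. Q (Suc t) k y = -\<infinity>) \<or> (\<forall>y\<in>X t. ereal m1 \<le> Q (Suc t) k y)"
    using step.IH step.prems by auto
  from \<theta>_bounded_below[OF t this] obtain m2 where
    "\<And>k. k \<ge> 1 \<Longrightarrow> L t k (x (t - 1) k) = -\<infinity> \<or> ereal m2 \<le> L t k (x (t - 1) k)"
    by blast
  from \<beta>_bounded[OF t this] obtain M where "M \<ge> 0"
    "\<And>k. k \<ge> 1 \<Longrightarrow> L t k (x (t - 1) k) \<noteq> -\<infinity> \<Longrightarrow> norm (\<beta> t k) \<le> M"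
    by blast
  with Q_lipschitz_of_\<beta>[OF t] have lip: "\<And>k y z. Q t k y \<le> Q t k z + ereal (M * norm (y - z))"
    by blast
  from Q_bounded_below_of_lipschitz[OF t \<open>M \<ge> 0\<close> this] \<open>M \<ge> 0\<close> lip show ?case by blast
qed

text \<open>There is no approximation error beyond the horizon, so \<open>L T k\<close> is the true
  cost-to-go function; \<open>Q T k\<close> is squeezed between them at every trial point, not only
  along a subsequence.\<close>

lemma last_stage_exact:
  assumes "k \<ge> 1"
  shows "V T (x (T - 1) k) = Q T k (x (T - 1) k)"
    and "Q T k (x (T - 1) k) = L T k (x (T - 1) k)"
proof -
  have "L T k (x (T - 1) k) = V T (x (T - 1) k)"
    by (simp add: lower_value_eq V_stage)
  moreover have "L T k (x (T - 1) k) \<le> Q T k (x (T - 1) k)"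
    using T_ge_2 assms by (intro lower_value_le_Q) auto
  moreover have "Q T k (x (T - 1) k) \<le> V T (x (T - 1) k)"
    using T_ge_2 by (intro Q_le_V) auto
  ultimately show "V T (x (T - 1) k) = Q T k (x (T - 1) k)"
    "Q T k (x (T - 1) k) = L T k (x (T - 1) k)" by auto
qed

end

section \<open>Convergence along the subsequence\<close>

lemma tendsto_of_gap:
  fixes g h :: "'b \<Rightarrow> ereal"
  assumes h: "(h \<longlongrightarrow> c) F" "\<bar>c\<bar> \<noteq> \<infinity>" and le: "\<forall>\<^sub>F k in F. g k \<le> h k"
    and gap: "\<And>e::real. 0 < e \<Longrightarrow> \<forall>\<^sub>F k in F. h k \<le> g k + ereal e"
  shows "(g \<longlongrightarrow> c) F"
proof (rule order_tendstoI)
  fix a assume "c < a"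
  with h(1) have "\<forall>\<^sub>F k in F. h k < a" by (rule order_tendstoD)
  with le show "\<forall>\<^sub>F k in F. g k < a" by eventually_elim auto
next
  fix a assume "a < c"
  obtain v where v: "c = ereal v" using h(2) by (cases c) auto
  obtain r where r: "a < ereal r" "r < v" using ereal_dense2[OF \<open>a < c\<close>] v by auto
  \<comment> \<open>Half of the distance from \<open>r\<close> to the limit: eventually
    \<open>h\<close> exceeds the midpoint \<open>r + e\<close>, and the gap \<open>e\<close> still
    leaves \<open>g\<close> above \<open>r\<close>.\<close>
  define e where "e = (v - r) / 2"
  have "\<forall>\<^sub>F k in F. ereal (r + e) < h k"
    using r by (intro order_tendstoD(1)[OF h(1)]) (simp add: v e_def field_simps)
  moreover have "\<forall>\<^sub>F k in F. h k \<le> g k + ereal e"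
    using r by (intro gap) (simp add: e_def)
  ultimately show "\<forall>\<^sub>F k in F. a < g k"
  proof eventually_elim
    case (elim k)
    then have "ereal (r + e) < g k + ereal e" by (rule less_le_trans)
    then have "ereal r < g k" by (cases "g k") auto
    with r show ?case by auto
  qed
qed

locale ddp_limit = ddp T x0 X f \<Gamma> x \<beta> S C Q
  for T x0 X and f :: "nat \<Rightarrow> 'a::euclidean_space \<times> 'a \<Rightarrow> ereal" and \<Gamma> x \<beta> S C Q +
  fixes xs :: "nat \<Rightarrow> 'a" and K :: "nat set"
  assumes xs_0: "xs 0 = x0"
    and xs_X: "t \<in> {1..T} \<Longrightarrow> xs t \<in> X t"
    and infinite_K: "infinite K" and K_pos: "K \<subseteq> {1..}"
    and x_tendsto_stage: "t \<in> {1..T} \<Longrightarrow> (x t \<longlongrightarrow> xs t) (inf sequentially (principal K))"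
begin

abbreviation "F \<equiv> inf sequentially (principal K)"

lemma eventually_F: "eventually P F \<longleftrightarrow> (\<exists>N. \<forall>k\<ge>N. k \<in> K \<longrightarrow> P k)"
  by (simp add: eventually_inf_principal eventually_sequentially)

lemma F_neq_bot: "F \<noteq> bot"
  using infinite_K unfolding trivial_limit_def eventually_F infinite_nat_iff_unbounded_le by blast

lemma eventually_F_pos: "\<forall>\<^sub>F k in F. k \<in> K \<and> 1 \<le> k"
  using K_pos by (auto simp: eventually_F)

lemma xs_mem: "t \<le> T \<Longrightarrow> xs t \<in> X t"
  using xs_X[of t] xs_0 X0 by (cases "t = 0") auto

lemma x_tendsto: "t \<le> T \<Longrightarrow> (x t \<longlongrightarrow> xs t) F"
proof (cases "t = 0")
  case True
  have "\<forall>\<^sub>F k in F. x0 = x 0 k"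
    using eventually_F_pos by eventually_elim (simp add: x_0)
  then show ?thesis
    unfolding True xs_0 by (rule tendsto_eventually[OF eventually_mono]) simp
qed (auto intro: x_tendsto_stage)

lemma V_tendsto:
  assumes "1 \<le> t" "t \<le> Suc T"
  shows "((\<lambda>k. V t (x (t - 1) k)) \<longlongrightarrow> V t (xs (t - 1))) F"
proof (rule continuous_on_tendsto_compose[OF V_continuous[OF assms]])
  have t: "t - 1 \<le> T" using assms by simp
  show "(x (t - 1) \<longlongrightarrow> xs (t - 1)) F" "xs (t - 1) \<in> X (t - 1)"
    using t by (auto intro: x_tendsto xs_mem)
  show "\<forall>\<^sub>F k in F. x (t - 1) k \<in> X (t - 1)"
    using eventually_F_pos by eventually_elim (erule x_mem[OF conjunct2 t])
qed

text \<open>The approximation used at iteration \<open>k\<close> is compared with the one built at an earlier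
  iteration \<open>j \<in> K\<close>, where it was nearly exact: it has not decreased at \<open>x t j\<close>, and \<open>x t j\<close> and
  \<open>x t k\<close> are close to each other.\<close>

lemma Q_gap:
  assumes t: "t \<in> {1..T}" and e: "0 < e"
    and gap: "\<And>e::real. t < T \<Longrightarrow> 0 < e \<Longrightarrow>
      \<forall>\<^sub>F k in F. V (Suc t) (x t k) \<le> L (Suc t) k (x t k) + ereal e"
  shows "\<forall>\<^sub>F k in F. V (Suc t) (x t k) \<le> Q (Suc t) (k - 1) (x t k) + ereal e"
proof (cases "t = T")
  case True
  then show ?thesis using e by simp
next
  case False
  with t have s: "Suc t \<in> {2..T}" "t < T" "t \<le> T" by auto
  obtain M where M: "0 \<le> M"
    "\<And>k y z. Q (Suc t) k y \<le> Q (Suc t) k z + ereal (M * norm (y - z))"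
    using Q_regular[of "Suc t"] s by auto
  have fin: "\<bar>V (Suc t) y\<bar> \<noteq> \<infinity>" if "y \<in> X t" for y
    using V_finite[of "Suc t" y] that s by simp
  obtain v where v: "V (Suc t) (xs t) = ereal v"
    using fin[OF xs_mem[OF s(3)]] by (cases "V (Suc t) (xs t)") auto
  \<comment> \<open>Error budget for two indices \<open>j\<close> and \<open>k\<close> satisfying
    \<open>P\<close>: e/4 for the gap at \<open>j\<close>, at most e/4 for the Lipschitz
    displacement through \<open>xs t\<close>, and e/2 for the difference between the values of
    \<open>V\<close> at the two trial points.\<close>
  define P where "P k \<longleftrightarrow> 1 \<le> k \<and> V (Suc t) (x t k) \<le> L (Suc t) k (x t k) + ereal (e/4) \<and>
    ereal (v - e/4) < V (Suc t) (x t k) \<and> V (Suc t) (x t k) < ereal (v + e/4) \<and>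
    M * norm (x t k - xs t) < e/8" for k
  have Vlim: "((\<lambda>k. V (Suc t) (x t k)) \<longlongrightarrow> ereal v) F"
    using V_tendsto[of "Suc t"] s by (simp add: v)
  have "((\<lambda>k. M * norm (x t k - xs t)) \<longlongrightarrow> M * norm (xs t - xs t)) F"
    by (intro tendsto_intros x_tendsto s)
  then have "\<forall>\<^sub>F k in F. M * norm (x t k - xs t) < e/8"
    using e by (intro order_tendstoD(2)) auto
  moreover have "\<forall>\<^sub>F k in F. ereal (v - e/4) < V (Suc t) (x t k)"
    "\<forall>\<^sub>F k in F. V (Suc t) (x t k) < ereal (v + e/4)"
    using e by (auto intro!: order_tendstoD[OF Vlim])
  moreover have "\<forall>\<^sub>F k in F. V (Suc t) (x t k) \<le> L (Suc t) k (x t k) + ereal (e/4)"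
    using e s by (intro gap) auto
  ultimately have evP: "\<forall>\<^sub>F k in F. P k"
    using eventually_F_pos by eventually_elim (simp add: P_def)
  then obtain j where j: "P j"
    using eventually_happens'[OF F_neq_bot] by blast
  have "\<forall>\<^sub>F k in F. j < k"
    unfolding eventually_F by (intro exI[of _ "Suc j"]) auto
  with evP show ?thesis
  proof eventually_elim
    case (elim k)
    obtain vj where vj: "V (Suc t) (x t j) = ereal vj"
      using fin[OF x_mem[OF _ s(3)], of j] j by (cases "V (Suc t) (x t j)") (auto simp: P_def)
    obtain vk where vk: "V (Suc t) (x t k) = ereal vk"
      using fin[OF x_mem[OF _ s(3)], of k] elim by (cases "V (Suc t) (x t k)") (auto simp: P_def)
    have "norm (x t j - x t k) \<le> norm (x t j - xs t) + norm (x t k - xs t)"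
      using norm_triangle_ineq4[of "x t j - xs t" "x t k - xs t"] by simp
    then have "M * norm (x t j - x t k) \<le> M * (norm (x t j - xs t) + norm (x t k - xs t))"
      using M(1) by (rule mult_left_mono)
    then have d: "M * norm (x t j - x t k) \<le> e/4"
      using j elim(1) by (simp add: P_def distrib_left)
    have "V (Suc t) (x t j) \<le> L (Suc t) j (x t j) + ereal (e/4)"
      using j by (simp add: P_def)
    also have "L (Suc t) j (x t j) \<le> Q (Suc t) j (x t j)"
      using lower_value_le_Q[OF s(1), of j] j by (simp add: P_def)
    \<comment> \<open>The strict inequality \<open>j < k\<close> makes \<open>k - 1\<close> an
      admissible later iteration for the second selection condition.\<close>
    also have "Q (Suc t) j (x t j) \<le> Q (Suc t) (k - 1) (x t j)"
      using selection[OF s(1), of j "k - 1"] j elim(2) by (simp add: P_def)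
    also have "Q (Suc t) (k - 1) (x t j)
        \<le> Q (Suc t) (k - 1) (x t k) + ereal (M * norm (x t j - x t k))"
      by (rule M)
    finally have "ereal vj \<le> Q (Suc t) (k - 1) (x t k) + ereal (M * norm (x t j - x t k)) + ereal (e/4)"
      by (simp add: vj add_right_mono)
    then show ?case
      using d j elim(1) by (cases "Q (Suc t) (k - 1) (x t k)") (auto simp: P_def vj vk)
  qed
qed

text \<open>The trial decision attains the lower value, so replacing the approximation by
  \<open>V\<close> there costs at most \<open>e\<close>. Keeping the sum with \<open>f t\<close>,
  rather than only the bound on \<open>V t\<close>, is what later yields optimality of the
  limit.\<close>

lemma lower_value_gap_of_Q_gap:
  assumes t: "t \<in> {1..T}"
    and "\<forall>\<^sub>F k in F. V (Suc t) (x t k) \<le> Q (Suc t) (k - 1) (x t k) + ereal e"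
  shows "\<forall>\<^sub>F k in F. f t (x t k, x (t - 1) k) + V (Suc t) (x t k) \<le> L t k (x (t - 1) k) + ereal e"
  using assms(2) eventually_F_pos
proof eventually_elim
  case (elim k)
  then have "f t (x t k, x (t - 1) k) + V (Suc t) (x t k)
      \<le> f t (x t k, x (t - 1) k) + (Q (Suc t) (k - 1) (x t k) + ereal e)"
    by (intro add_left_mono) simp
  also have "\<dots> = L t k (x (t - 1) k) + ereal e"
    using elim by (subst lower_value_trial[OF _ t]) (auto simp: add.assoc)
  finally show ?case .
qed

lemma V_le_stage_cost:
  assumes "t \<in> {1..T}" "1 \<le> k"
  shows "V t (x (t - 1) k) \<le> f t (x t k, x (t - 1) k) + V (Suc t) (x t k)"
  using assms x_feasible[OF assms(2,1)] by (subst V_stage) (auto intro!: stage_value_le)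

lemma lower_value_gap:
  assumes "1 \<le> t" "t \<le> T" "0 < e"
  shows "\<forall>\<^sub>F k in F. V t (x (t - 1) k) \<le> L t k (x (t - 1) k) + ereal e"
proof -
  \<comment> \<open>One backward step. Its hypothesis holds for all tolerances, since a smaller one
    is spent inside, and is vacuous at \<open>t = T\<close>, so the base case is an
    instance.\<close>
  have gap: "\<forall>\<^sub>F k in F. V t (x (t - 1) k) \<le> L t k (x (t - 1) k) + ereal e"
    if t: "t \<in> {1..T}" and e: "0 < e"
      and next_gap: "\<And>e::real. t < T \<Longrightarrow> 0 < e \<Longrightarrow>
        \<forall>\<^sub>F k in F. V (Suc t) (x t k) \<le> L (Suc t) k (x t k) + ereal e" for t e
  proof -
    have "\<forall>\<^sub>F k in F. V (Suc t) (x t k) \<le> Q (Suc t) (k - 1) (x t k) + ereal e"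
      by (rule Q_gap[OF t e next_gap])
    from lower_value_gap_of_Q_gap[OF t this] eventually_F_pos show ?thesis
      by eventually_elim (use V_le_stage_cost[OF t] in \<open>blast intro: order_trans\<close>)
  qed
  show ?thesis
    using assms(2,1,3)
  proof (induction t arbitrary: e rule: inc_induct)
    case base
    then show ?case by (intro gap) auto
  next
    case (step t)
    then show ?case by (intro gap) auto
  qed
qed

lemma stage_cost_le_lower_value:
  assumes t: "t \<in> {1..T}" and "0 < e"
  shows "\<forall>\<^sub>F k in F. f t (x t k, x (t - 1) k) + V (Suc t) (x t k) \<le> L t k (x (t - 1) k) + ereal e"
proof (intro lower_value_gap_of_Q_gap Q_gap t \<open>0 < e\<close>)
  fix e :: real assume "t < T" "0 < e"
  then show "\<forall>\<^sub>F k in F. V (Suc t) (x t k) \<le> L (Suc t) k (x t k) + ereal e"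
    using lower_value_gap[of "Suc t" e] by simp
qed

lemma lower_value_tendsto:
  assumes t: "t \<in> {1..T}"
  shows "((\<lambda>k. L t k (x (t - 1) k)) \<longlongrightarrow> V t (xs (t - 1))) F"
proof (rule tendsto_of_gap)
  show "((\<lambda>k. V t (x (t - 1) k)) \<longlongrightarrow> V t (xs (t - 1))) F" "\<bar>V t (xs (t - 1))\<bar> \<noteq> \<infinity>"
    using t by (intro V_tendsto V_finite xs_mem; auto)+
  show "\<forall>\<^sub>F k in F. L t k (x (t - 1) k) \<le> V t (x (t - 1) k)"
    using lower_value_le_V[OF t] by simp
  show "\<forall>\<^sub>F k in F. V t (x (t - 1) k) \<le> L t k (x (t - 1) k) + ereal e" if "0 < e" for e
    using t that by (intro lower_value_gap) auto
qed

lemma Q_tendsto: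
  assumes t: "t \<in> {2..T}"
  shows "((\<lambda>k. Q t k (x (t - 1) k)) \<longlongrightarrow> V t (xs (t - 1))) F"
proof (rule tendsto_sandwich)
  show "\<forall>\<^sub>F k in F. L t k (x (t - 1) k) \<le> Q t k (x (t - 1) k)"
    using eventually_F_pos by eventually_elim (erule lower_value_le_Q[OF t conjunct2])
  show "\<forall>\<^sub>F k in F. Q t k (x (t - 1) k) \<le> V t (x (t - 1) k)"
    using t by (auto intro!: always_eventually Q_le_V)
  show "((\<lambda>k. L t k (x (t - 1) k)) \<longlongrightarrow> V t (xs (t - 1))) F"
    using t by (intro lower_value_tendsto) auto
  show "((\<lambda>k. V t (x (t - 1) k)) \<longlongrightarrow> V t (xs (t - 1))) F"
    using t by (intro V_tendsto) auto
qed

text \<open>Every lower value is at most \<open>V 1 x0\<close>, and the running supremum never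
  decreases; a single good iteration in \<open>K\<close> therefore controls all later ones, inside
  or outside \<open>K\<close>.\<close>

lemma SUP_lower_value_tendsto: "(\<lambda>k. SUP m\<in>{1..k}. L 1 m x0) \<longlonglongrightarrow> V 1 x0"
proof (rule order_tendstoI)
  have T1: "1 \<in> {1..T}" using T_ge_2 by simp
  fix a assume "a < V 1 x0"
  then have "\<forall>\<^sub>F k in F. a < L 1 k (x 0 k)"
    using lower_value_tendsto[OF T1] by (intro order_tendstoD(1)) (auto simp: xs_0)
  with eventually_F_pos have "\<forall>\<^sub>F k in F. 1 \<le> k \<and> a < L 1 k x0"
    by eventually_elim (auto simp: x_0)
  then obtain k0 where k0: "1 \<le> k0" "a < L 1 k0 x0"
    using eventually_happens'[OF F_neq_bot] by blast
  have "a < (SUP m\<in>{1..k}. L 1 m x0)" if "k0 \<le> k" for k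
    using k0 that by (auto simp: less_SUP_iff)
  then show "\<forall>\<^sub>F k in sequentially. a < (SUP m\<in>{1..k}. L 1 m x0)"
    by (rule eventually_sequentiallyI)
next
  have T1: "1 \<in> {1..T}" using T_ge_2 by simp
  fix a assume "V 1 x0 < a"
  moreover have "(SUP m\<in>{1..k}. L 1 m x0) \<le> V 1 x0" for k
    by (intro SUP_least lower_value_le_V T1)
  ultimately show "\<forall>\<^sub>F k in sequentially. (SUP m\<in>{1..k}. L 1 m x0) < a"
    by (intro always_eventually allI) (rule le_less_trans)
qed

section \<open>Optimality of the accumulation point\<close>

lemma xs_feasible:
  assumes t: "t \<in> {1..T}"
  shows "xs t \<in> \<Gamma> t (xs (t - 1))"
proof -
  have "((\<lambda>k. (x t k, x (t - 1) k)) \<longlongrightarrow> (xs t, xs (t - 1))) F"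
    using t by (intro tendsto_Pair x_tendsto) auto
  moreover have "\<forall>\<^sub>F k in F. (x t k, x (t - 1) k) \<in> {(x, y). x \<in> \<Gamma> t y}"
    using eventually_F_pos by eventually_elim (use x_feasible t in auto)
  ultimately have "(xs t, xs (t - 1)) \<in> {(x, y). x \<in> \<Gamma> t y}"
    by (intro Lim_in_closed_set[OF \<Gamma>_closed[OF t] _ F_neq_bot])
  then show ?thesis by simp
qed

lemma xs_stage_optimal:
  assumes t: "t \<in> {1..T}"
  shows "f t (xs t, xs (t - 1)) + V (Suc t) (xs t) \<le> V t (xs (t - 1))"
proof (rule ereal_le_epsilon2)
  fix e :: real assume e: "0 < e"
  have t': "t \<le> T" "t - 1 \<le> T" "1 \<le> t" "t \<le> Suc T" using t by auto
  have fin: "\<bar>V t y\<bar> \<noteq> \<infinity>" if "y \<in> X (t - 1)" for y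
    using V_finite[of t y] that t' by simp
  have fin': "\<bar>V (Suc t) y\<bar> \<noteq> \<infinity>" if "y \<in> X t" for y
    using V_finite[of "Suc t" y] that t' by simp
  \<comment> \<open>The stage cost is only lower semicontinuous, so it is isolated on the left; the
    \<open>V\<close> terms on the right converge, and their finiteness makes the subtraction
    legitimate.\<close>
  have "f t (xs t, xs (t - 1)) \<le> V t (xs (t - 1)) + ereal e - V (Suc t) (xs t)"
  proof (rule lsc_ereal_le_of_tendsto[where F = F and w = "\<lambda>k. (x t k, x (t - 1) k)"])
    show "lsc_ereal (f t)" using f_convex_lsc[OF t] by simp
    show "((\<lambda>k. (x t k, x (t - 1) k)) \<longlongrightarrow> (xs t, xs (t - 1))) F"
      by (intro tendsto_Pair x_tendsto t')
    show "((\<lambda>k. V t (x (t - 1) k) + ereal e - V (Suc t) (x t k))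
        \<longlongrightarrow> V t (xs (t - 1)) + ereal e - V (Suc t) (xs t)) F"
      using fin[OF xs_mem[OF t'(2)]] fin'[OF xs_mem[OF t'(1)]] V_tendsto[of "Suc t"] t'
      by (intro tendsto_diff_ereal tendsto_add_ereal tendsto_const V_tendsto) auto
    show "\<forall>\<^sub>F k in F. f t (x t k, x (t - 1) k) \<le> V t (x (t - 1) k) + ereal e - V (Suc t) (x t k)"
      using stage_cost_le_lower_value[OF t e] eventually_F_pos
    proof eventually_elim
      case (elim k)
      note elim(1)
      also have "L t k (x (t - 1) k) + ereal e \<le> V t (x (t - 1) k) + ereal e"
        by (intro add_right_mono lower_value_le_V t)
      finally show ?case
        using fin'[OF x_mem[OF _ t'(1), of k]] elim(2) by (subst ereal_le_minus_iff) auto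
    qed
  qed (fact F_neq_bot)
  then show "f t (xs t, xs (t - 1)) + V (Suc t) (xs t) \<le> V t (xs (t - 1)) + ereal e"
    using fin'[OF xs_mem[OF t'(1)]] by (subst (asm) ereal_le_minus_iff) auto
qed

lemma xs_optimal: "optimal_trajectory T x0 f \<Gamma> xs"
  using xs_feasible xs_stage_optimal xs_0
  by (intro optimal_trajectoryI) (auto simp: feasible_trajectory_def)

end

section \<open>Closedness and convexity of the graph of the concrete constraints\<close>

lemma stage_feasible_graph:
  "{(x, y). x \<in> stage_feasible X p g q A B b t y} = (X t \<times> UNIV) \<inter>
    ((\<Inter>i\<in>{1..p}. {z. g t i z \<le> 0}) \<inter>
     (\<Inter>i\<in>{1..q t}. {z. A t i \<bullet> fst z + B t i \<bullet> snd z = b t i}))"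
  by (auto simp: stage_feasible_def ineq_constraint_def eq_constraint_def)

lemma closed_stage_feasible_graph:
  fixes X :: "nat \<Rightarrow> 'a::euclidean_space set"
  assumes "closed (X t)" "\<And>i. i \<in> {1..p} \<Longrightarrow> lsc_ereal (g t i)"
  shows "closed {(x, y). x \<in> stage_feasible X p g q A B b t y}"
  unfolding stage_feasible_graph
  by (intro closed_Int closed_Times closed_INT ballI closed_UNIV assms lsc_ereal_closed_sublevel
      closed_Collect_eq continuous_intros)

lemma convex_stage_feasible_graph:
  fixes X :: "nat \<Rightarrow> 'a::euclidean_space set"
  assumes "convex (X t)" "\<And>i. i \<in> {1..p} \<Longrightarrow> convex_ereal (g t i)"
  shows "convex {(x, y). x \<in> stage_feasible X p g q A B b t y}"
  unfolding stage_feasible_graph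
proof (intro convex_Int convex_Times convex_INT convex_UNIV assms)
  fix i assume "i \<in> {1..p}"
  then show "convex {z. g t i z \<le> 0}"
    using convex_ereal_sublevel[OF assms(2)] by (auto simp: convex_def)
next
  fix i
  \<comment> \<open>In the product space an equality constraint is a hyperplane with normal
    \<open>(A t i, B t i)\<close>.\<close>
  have "{z. A t i \<bullet> fst z + B t i \<bullet> snd z = b t i} = {z. (A t i, B t i) \<bullet> z = b t i}"
    by (auto simp: inner_prod_def)
  then show "convex {z. A t i \<bullet> fst z + B t i \<bullet> snd z = b t i}"
    by (simp add: convex_hyperplane)
qed

theorem theorem5p2:
  fixes T p :: nat
    and x0 :: "real ^ 'n"
    and X :: "nat \<Rightarrow> (real ^ 'n) set"
    and f :: "nat \<Rightarrow> (real ^ 'n) \<times> (real ^ 'n) \<Rightarrow> ereal"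
    and g :: "nat \<Rightarrow> nat \<Rightarrow> (real ^ 'n) \<times> (real ^ 'n) \<Rightarrow> ereal"
    and q :: "nat \<Rightarrow> nat"
    and A B :: "nat \<Rightarrow> nat \<Rightarrow> real ^ 'n"
    and b :: "nat \<Rightarrow> nat \<Rightarrow> real"
    and x \<beta> :: "nat \<Rightarrow> nat \<Rightarrow> real ^ 'n"
    and S :: "nat \<Rightarrow> nat \<Rightarrow> nat set"
    and C Q :: "nat \<Rightarrow> nat \<Rightarrow> real ^ 'n \<Rightarrow> ereal"
    and xs :: "nat \<Rightarrow> real ^ 'n"
    and K :: "nat set"
  defines "\<Gamma> \<equiv> stage_feasible X p g q A B b"
  assumes T: "T \<ge> 2"
    and X0: "X 0 = {x0}"
    and asm_a: "\<And>t. t \<in> {1..T} \<Longrightarrow> X t \<noteq> {} \<and> convex (X t) \<and> compact (X t)"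
    and asm_b: "\<And>t. t \<in> {1..T} \<Longrightarrow> proper_ereal (f t) \<and> convex_ereal (f t) \<and> lsc_ereal (f t)"
    and asm_c: "\<And>t i. t \<in> {1..T} \<Longrightarrow> i \<in> {1..p} \<Longrightarrow>
              (\<forall>z. g t i z \<noteq> -\<infinity>) \<and> convex_ereal (g t i) \<and> lsc_ereal (g t i)"
    and asm_d: "\<And>t. t \<in> {1..T} \<Longrightarrow>
              \<exists>\<epsilon>>0. X t \<times> enlargement (X (t - 1)) \<epsilon> \<subseteq> edom (f t) \<and>
                (\<forall>y\<in>enlargement (X (t - 1)) \<epsilon>. \<exists>z\<in>X t.
                   ineq_constraint p g t z y \<and> eq_constraint q A B b t z y)"
    and asm_e: "\<And>t. t \<in> {2..T} \<Longrightarrow>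
              \<exists>z y. (z, y) \<in> (rel_interior (X t) \<times> X (t - 1)) \<inter>
                            rel_interior {(z', y'). ineq_constraint p g t z' y'} \<and>
                ineq_constraint p g t z y \<and> eq_constraint q A B b t z y"
    and run: "ddp_run T x0 f \<Gamma> x \<beta> S C Q"
    and selection: "\<And>t k1 k2. t \<in> {2..T} \<Longrightarrow> k1 \<ge> 1 \<Longrightarrow> k2 \<ge> k1 \<Longrightarrow>
              Q t k1 (x (t - 1) k1) \<ge> C t k1 (x (t - 1) k1) \<and>
              (\<forall>j\<in>{1..k2}. Q t k2 (x (t - 1) j) \<ge> Q t k1 (x (t - 1) j))"
    and xs0: "xs 0 = x0"
    and xs: "\<And>t. t \<in> {1..T} \<Longrightarrow> xs t \<in> X t"
    and K: "infinite K" "K \<subseteq> {1..}"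
    and lim: "\<And>t. t \<in> {1..T} \<Longrightarrow>
              ((\<lambda>k. x t k) \<longlongrightarrow> xs t) (inf sequentially (principal K))"
  shows
    "(\<forall>k\<ge>1.
        cost_to_go T f \<Gamma> (T + 1) (x T k) = Q (T + 1) k (x T k) \<and>
        cost_to_go T f \<Gamma> T (x (T - 1) k) = Q T k (x (T - 1) k) \<and>
        Q T k (x (T - 1) k) = lower_value f \<Gamma> Q T k (x (T - 1) k)) \<and>
     (\<forall>t\<in>{2..T - 1}.
        ((\<lambda>k. Q t k (x (t - 1) k)) \<longlongrightarrow> cost_to_go T f \<Gamma> t (xs (t - 1)))
          (inf sequentially (principal K)) \<and>
        ((\<lambda>k. lower_value f \<Gamma> Q t k (x (t - 1) k)) \<longlongrightarrow> cost_to_go T f \<Gamma> t (xs (t - 1)))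
          (inf sequentially (principal K))) \<and>
     ((\<lambda>k. SUP m\<in>{1..k}. lower_value f \<Gamma> Q 1 m x0) \<longlonglongrightarrow> cost_to_go T f \<Gamma> 1 x0) \<and>
     optimal_trajectory T x0 f \<Gamma> xs"
proof -
  interpret ddp_limit T x0 X f \<Gamma> x \<beta> S C Q xs K
  proof unfold_locales
    fix t assume t: "t \<in> {1..T}"
    show "convex {(z, y). z \<in> \<Gamma> t y}"
      unfolding \<Gamma>_def using asm_a[OF t] asm_c[OF t] by (intro convex_stage_feasible_graph) auto
    show "closed {(z, y). z \<in> \<Gamma> t y}"
      unfolding \<Gamma>_def using asm_a[OF t] asm_c[OF t]
      by (intro closed_stage_feasible_graph) (auto intro: compact_imp_closed)
    obtain \<epsilon> where "\<epsilon> > 0" "X t \<times> enlargement (X (t - 1)) \<epsilon> \<subseteq> edom (f t)"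
      "\<forall>y\<in>enlargement (X (t - 1)) \<epsilon>. \<exists>z\<in>X t.
         ineq_constraint p g t z y \<and> eq_constraint q A B b t z y"
      using asm_d[OF t] by blast
    then show "\<exists>\<epsilon>>0. X t \<times> enlargement (X (t - 1)) \<epsilon> \<subseteq> edom (f t) \<and>
        (\<forall>y\<in>enlargement (X (t - 1)) \<epsilon>. \<Gamma> t y \<noteq> {})"
      unfolding \<Gamma>_def stage_feasible_def by (intro exI[of _ \<epsilon>]) fastforce
  next
    fix t y show "\<Gamma> t y \<subseteq> X t"
      unfolding \<Gamma>_def stage_feasible_def by blast
  qed (fact X0 asm_a asm_b T run selection xs0 xs K lim)+
  show ?thesis
    using last_stage_exact Q_tendsto lower_value_tendsto SUP_lower_value_tendsto xs_optimal T
    by (auto simp del: One_nat_def simp flip: Suc_eq_plus1)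
qed

end
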